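(* Let $a>b>0$ and $n\ge3$ be integers. A $\mathrm{LC}(a^1b^{n-1})$ exists if and only if $a\le (n-1)b$.
   Context: A latin cube of order $N$ is an $N\times N\times N$ array on $N$ symbols such that any two cells whose coordinates differ in exactly one position contain different symbols; a subcube is an $m\times m\times m$ subarray (indices in each coordinate from chosen $m$-sets) that is itself a latin cube of order $m$; subcubes are disjoint if they share no index in any coordinate and no symbol. $\mathrm{LC}(a^1b^{n-1})$ denotes a latin cube of order $a+(n-1)b$ with pairwise disjoint subcubes, one of order $a$ and $n-1$ of order $b$. *)

theory Defs
  imports Main "HOL-Library.Disjoint_Sets"
begin

text \<open>
  The index sets and the symbol set are parameters, so that the same predicate applies
  to a whole array and to a subarray of it.
\<close>

definition latin_cube_on ::
  "nat \<Rightarrow> 'i set \<Rightarrow> 'j set \<Rightarrow> 'k set \<Rightarrow> 's set \<Rightarrow> ('i \<Rightarrow> 'j \<Rightarrow> 'k \<Rightarrow> 's) \<Rightarrow> bool" where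
  "latin_cube_on m I J K S L \<longleftrightarrow>
     finite I \<and> card I = m \<and> finite J \<and> card J = m \<and> finite K \<and> card K = m \<and>
     finite S \<and> card S = m \<and>
     (\<forall>i\<in>I. \<forall>j\<in>J. \<forall>k\<in>K. L i j k \<in> S) \<and>
     (\<forall>i\<in>I. \<forall>i'\<in>I. \<forall>j\<in>J. \<forall>k\<in>K. i \<noteq> i' \<longrightarrow> L i j k \<noteq> L i' j k) \<and>
     (\<forall>i\<in>I. \<forall>j\<in>J. \<forall>j'\<in>J. \<forall>k\<in>K. j \<noteq> j' \<longrightarrow> L i j k \<noteq> L i j' k) \<and>
     (\<forall>i\<in>I. \<forall>j\<in>J. \<forall>k\<in>K. \<forall>k'\<in>K. k \<noteq> k' \<longrightarrow> L i j k \<noteq> L i j k')"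

definition latin_cube :: "nat \<Rightarrow> (nat \<Rightarrow> nat \<Rightarrow> nat \<Rightarrow> nat) \<Rightarrow> bool" where
  "latin_cube N L \<longleftrightarrow> latin_cube_on N {..<N} {..<N} {..<N} {..<N} L"

text \<open>
  For a latin cube \<open>L\<close> of order \<open>N\<close>: the subarray with index sets \<open>I\<close>, \<open>J\<close>, \<open>K\<close> is a subcube
  of order \<open>m\<close>. Since every line of a latin cube contains each symbol, \<open>S\<close> is exactly the
  set of symbols occurring in the subarray.
\<close>

definition subcube ::
  "nat \<Rightarrow> (nat \<Rightarrow> nat \<Rightarrow> nat \<Rightarrow> nat) \<Rightarrow> nat \<Rightarrow> nat set \<Rightarrow> nat set \<Rightarrow> nat set \<Rightarrow> nat set \<Rightarrow> bool" where
  "subcube N L m I J K S \<longleftrightarrow>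
     I \<subseteq> {..<N} \<and> J \<subseteq> {..<N} \<and> K \<subseteq> {..<N} \<and> S \<subseteq> {..<N} \<and> latin_cube_on m I J K S L"

text \<open>
  \<open>is_LC [h\<^sub>1, \<dots>, h\<^sub>n] L\<close>: \<open>L\<close> is a latin cube of order \<open>h\<^sub>1 + \<dots> + h\<^sub>n\<close> with pairwise disjoint
  subcubes of orders \<open>h\<^sub>1, \<dots>, h\<^sub>n\<close>.
\<close>

definition is_LC :: "nat list \<Rightarrow> (nat \<Rightarrow> nat \<Rightarrow> nat \<Rightarrow> nat) \<Rightarrow> bool" where
  "is_LC hs L \<longleftrightarrow>
     latin_cube (sum_list hs) L \<and>
     (\<exists>I J K S :: nat \<Rightarrow> nat set.
        (\<forall>t < length hs. subcube (sum_list hs) L (hs ! t) (I t) (J t) (K t) (S t)) \<and>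
        disjoint_family_on I {..<length hs} \<and>
        disjoint_family_on J {..<length hs} \<and>
        disjoint_family_on K {..<length hs} \<and>
        disjoint_family_on S {..<length hs})"

end

theory Submission imports Defs begin

text \<open>
  Necessity: fix a layer \<open>i\<close> of the subcube of order \<open>a\<close> and a row \<open>j\<close> outside it. The \<open>a\<close> cells
  of that row in the columns of the subcube avoid its \<open>a\<close> symbols, so \<open>2 a\<close> is at most the order.

  Sufficiency: if \<open>Q\<close> is a latin square, then the equation \<open>Q (L x y z) z = Q x y\<close> defines a latin
  cube, and subsquares of \<open>Q\<close> that share no rows and no columns, but possibly symbols, become
  disjoint subcubes. Such a \<open>Q\<close> of order \<open>a + v\<close>, where \<open>v = (n - 1) b\<close>, is obtained from the
  subtraction table of \<open>Z\<^sub>v\<close>, where the diagonal blocks of the residue classes modulo \<open>n - 1\<close> all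
  carry the \<open>b\<close> multiples of \<open>n - 1\<close>. Keep the entries in a set \<open>M\<close> of \<open>a\<close> symbols that contains
  these multiples, replace every other entry \<open>d\<close> in column \<open>y\<close> by a new symbol \<open>y + \<phi> d\<close>, where \<open>\<phi> d\<close>
  and \<open>\<phi> d - d\<close> are both injective, and border the table by \<open>a\<close> rows and \<open>a\<close> columns holding the
  missing new symbols.
\<close>

section \<open>Counting bound for a subcube\<close>

lemma latin_cube_on_inj:
  assumes "latin_cube_on m I J K S L"
  shows "i \<in> I \<Longrightarrow> k \<in> K \<Longrightarrow> inj_on (\<lambda>j. L i j k) J"
    and "i \<in> I \<Longrightarrow> j \<in> J \<Longrightarrow> inj_on (\<lambda>k. L i j k) K"
  using assms unfolding latin_cube_on_def inj_on_def by metis+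

lemma subcube_order_le:
  assumes L: "latin_cube N L" and sub: "subcube N L a I J K S" and "0 < a" "a < N"
  shows "2 * a \<le> N"
proof -
  have lat: "latin_cube_on N {..<N} {..<N} {..<N} {..<N} L"
    using L unfolding latin_cube_def .
  have incl: "I \<subseteq> {..<N}" "J \<subseteq> {..<N}" "K \<subseteq> {..<N}" "S \<subseteq> {..<N}"
    and on: "latin_cube_on a I J K S L"
    using sub unfolding subcube_def by auto
  have card: "finite J" "card I = a" "card J = a" "card K = a" "card S = a" "finite S"
    and inS: "\<And>i j k. i \<in> I \<Longrightarrow> j \<in> J \<Longrightarrow> k \<in> K \<Longrightarrow> L i j k \<in> S"
    using on unfolding latin_cube_on_def by auto
  obtain i where i: "i \<in> I"
    using card \<open>0 < a\<close> by fastforce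
  have "J \<noteq> {..<N}"
    using card \<open>a < N\<close> by auto
  then obtain j where j: "j < N" "j \<notin> J"
    using incl by auto
  have iN: "i < N"
    using i incl by auto
  have "L i j k \<in> {..<N} - S" if k: "k \<in> K" for k
  proof -
    have kN: "k < N" using k incl by auto
    have "L i j k \<notin> S"
    proof
      assume "L i j k \<in> S"
      \<comment> \<open>By counting, the line of the subcube through \<open>i\<close> and
        \<open>k\<close> already uses up \<open>S\<close>, so a symbol of \<open>S\<close> at
        \<open>j\<close> would occur twice in the full line.\<close>
      moreover have "(\<lambda>j. L i j k) ` J = S"
        using card inS i k latin_cube_on_inj(1)[OF on i k]
        by (intro card_subset_eq) (auto simp: card_image)
      ultimately obtain j' where "j' \<in> J" "L i j k = L i j' k"
        by auto
      moreover have "inj_on (\<lambda>j. L i j k) {..<N}"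
        using latin_cube_on_inj(1)[OF lat] iN kN by auto
      ultimately show False
        using j incl by (auto dest!: inj_onD)
    qed
    then show ?thesis
      using lat iN j kN unfolding latin_cube_on_def by auto
  qed
  then have "(\<lambda>k. L i j k) ` K \<subseteq> {..<N} - S"
    by auto
  moreover have "inj_on (\<lambda>k. L i j k) K"
    using latin_cube_on_inj(2)[OF lat, of i j] iN j incl by (auto intro: inj_on_subset)
  ultimately have "a \<le> card ({..<N} - S)"
    using card by (metis card_image card_mono finite_Diff finite_lessThan)
  then show ?thesis
    using card incl \<open>a < N\<close> by (simp add: card_Diff_subset)
qed

section \<open>From latin squares to latin cubes\<close>

text \<open>\<open>L x y z\<close> will be the row in which column \<open>z\<close> of
  \<open>Q\<close> holds the symbol \<open>Q x y\<close>. The symbols of the cube are thus row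
  indices, so \<open>R t\<close> serves in all four roles and the symbol sets \<open>M t\<close> of
  the subsquares may overlap.\<close>

lemma is_LC_from_square:
  fixes Q :: "nat \<Rightarrow> nat \<Rightarrow> 's"
  assumes Y: "finite Y" "card Y = sum_list hs"
    and QY: "\<And>x y. x < sum_list hs \<Longrightarrow> y < sum_list hs \<Longrightarrow> Q x y \<in> Y"
    and row: "\<And>x. x < sum_list hs \<Longrightarrow> inj_on (Q x) {..<sum_list hs}"
    and col: "\<And>y. y < sum_list hs \<Longrightarrow> inj_on (\<lambda>x. Q x y) {..<sum_list hs}"
    and R: "\<And>t. t < length hs \<Longrightarrow> R t \<subseteq> {..<sum_list hs} \<and> card (R t) = hs ! t"
    and disj: "disjoint_family_on R {..<length hs}"
    and M: "\<And>t. t < length hs \<Longrightarrow> finite (M t) \<and> card (M t) = hs ! t"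
    and QM: "\<And>t x y. t < length hs \<Longrightarrow> x \<in> R t \<Longrightarrow> y \<in> R t \<Longrightarrow> Q x y \<in> M t"
  shows "\<exists>L. is_LC hs L"
proof -
  define N where "N = sum_list hs"
  note [folded N_def] = Y QY row col R
  note Y = this(1,2) and QY = this(3) and row = this(4) and col = this(5) and R = this(6)
  define L where "L x y z = inv_into {..<N} (\<lambda>r. Q r z) (Q x y)" for x y z
  have onto: "(\<lambda>r. Q r z) ` {..<N} = Y" if "z < N" for z
    using that Y QY col by (intro card_subset_eq) (auto simp: card_image)
  have L: "L x y z < N" "Q (L x y z) z = Q x y" if "x < N" "y < N" "z < N" for x y z
  proof -
    have "Q x y \<in> (\<lambda>r. Q r z) ` {..<N}"
      using onto QY that by auto
    from inv_into_into[OF this] f_inv_into_f[OF this]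
    show "L x y z < N" "Q (L x y z) z = Q x y"
      unfolding L_def by auto
  qed
  have inj1: "x = x'" if "L x y z = L x' y z" "x < N" "x' < N" "y < N" "z < N" for x x' y z
    using that L[of x y z] L[of x' y z] col[of y] by (auto dest: inj_onD)
  have inj2: "y = y'" if "L x y z = L x y' z" "x < N" "y < N" "y' < N" "z < N" for x y y' z
    using that L[of x y z] L[of x y' z] row[of x] by (auto dest: inj_onD)
  \<comment> \<open>If \<open>r\<close> is the common value, row \<open>r\<close> has the entry
    \<open>Q x y\<close> in both columns \<open>z\<close> and \<open>z'\<close>.\<close>
  have inj3: "z = z'" if "L x y z = L x y z'" "x < N" "y < N" "z < N" "z' < N" for x y z z'
    using that L[of x y z] L[of x y z'] inj_onD[OF row[of "L x y z"], of z z'] by simp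
  have "latin_cube N L"
    unfolding latin_cube_def latin_cube_on_def by (auto intro: L(1) dest: inj1 inj2 inj3)
  moreover have "subcube N L (hs ! t) (R t) (R t) (R t) (R t)" if t: "t < length hs" for t
  proof -
    have RN: "R t \<subseteq> {..<N}" and RC: "card (R t) = hs ! t" and lt: "\<And>x. x \<in> R t \<Longrightarrow> x < N"
      using R[OF t] by auto
    have "L x y z \<in> R t" if xyz: "x \<in> R t" "y \<in> R t" "z \<in> R t" for x y z
    proof -
      have "inj_on (\<lambda>r. Q r z) (R t)"
        using inj_on_subset[OF col RN] lt xyz by auto
      \<comment> \<open>By counting, column \<open>z\<close> restricted to the rows
        \<open>R t\<close> contains all of \<open>M t\<close>; hence the row holding
        \<open>Q x y\<close> in that column belongs to \<open>R t\<close>.\<close>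
      then have "(\<lambda>r. Q r z) ` R t = M t"
        using M[OF t] QM[OF t] RC xyz by (intro card_subset_eq) (auto simp: card_image)
      then obtain r where "r \<in> R t" "Q r z = Q x y"
        using QM[OF t] xyz by (metis (no_types, lifting) imageE)
      moreover have "r = L x y z"
        using calculation L[of x y z] lt xyz by (intro inj_onD[OF col[of z]]) auto
      ultimately show ?thesis by simp
    qed
    moreover have "finite (R t)"
      using RN finite_subset by blast
    ultimately show ?thesis
      unfolding subcube_def latin_cube_on_def
      using RN RC by (auto dest: lt inj1 inj2 inj3)
  qed
  ultimately have "is_LC hs L"
    unfolding is_LC_def N_def[symmetric] using disj by blast
  then show ?thesis
    by blast
qed

section \<open>Near-orthomorphisms of cyclic groups\<close>

text \<open>
  For odd \<open>v\<close> doubling works. For even \<open>v\<close> it is shifted by one on the upper half of the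
  residues, and the only collision is then between \<open>0\<close> and \<open>v - 1\<close>.
\<close>

lemma ex_near_orthomorphism:
  fixes v :: int
  assumes "E \<subseteq> {0<..<v}"
  obtains \<phi> where "\<phi> ` E \<subseteq> {0..<v}" "inj_on \<phi> E" "inj_on (\<lambda>d. (\<phi> d - d) mod v) E"
proof
  let ?\<phi> = "\<lambda>d. if 2 * d < v then 2 * d else if even v then 2 * d + 1 - v else 2 * d - v"
  have E: "0 < d" "d < v" if "d \<in> E" for d
    using assms that by auto
  show "?\<phi> ` E \<subseteq> {0..<v}"
    using E by (force split: if_splits)
  \<comment> \<open>Parity separates the branches: values on the lower half are even, those on the
    upper half odd.\<close>
  show "inj_on ?\<phi> E"
    by (rule inj_onI) (simp split: if_splits, presburger+)
  \<comment> \<open>For even \<open>v\<close> the differences skip \<open>v div 2\<close> and wrap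
    around to \<open>0\<close> at \<open>d = v - 1\<close>; no other element gives \<open>0\<close>,
    because \<open>0\<close> is not in \<open>E\<close>.\<close>
  have mod: "(?\<phi> d - d) mod v =
      (if 2 * d < v \<or> odd v then d else if d = v - 1 then 0 else d + 1)" if "d \<in> E" for d
  proof -
    have "(d - v) mod v = d" "d \<noteq> v - 1 \<Longrightarrow> (d + 1 - v) mod v = d + 1"
      using E[OF that] by (simp_all add: mod_diff_right_eq[symmetric])
    then show ?thesis
      using E[OF that] by (auto simp: algebra_simps)
  qed
  show "inj_on (\<lambda>d. (?\<phi> d - d) mod v) E"
  proof (rule inj_onI)
    fix d d' assume d: "d \<in> E" "d' \<in> E" and "(?\<phi> d - d) mod v = (?\<phi> d' - d') mod v"
    then show "d = d'"
      unfolding mod[OF d(1)] mod[OF d(2)] using E[OF d(1)] E[OF d(2)]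
      by (auto split: if_splits)
  qed
qed

section \<open>The bordered subtraction table\<close>

lemma mod_add_left_cancel:
  fixes v :: int
  assumes "(x + p) mod v = (x + q) mod v" "p \<in> {0..<v}" "q \<in> {0..<v}"
  shows "p = q"
proof -
  have "(x + p - x) mod v = (x + q - x) mod v"
    using assms(1) by (metis mod_diff_left_eq)
  then show ?thesis using assms by simp
qed

text \<open>Here \<open>m\<close> stands for \<open>n - 1\<close>. The bounds on \<open>a\<close>
  leave room for a set of \<open>a\<close> residues between the \<open>b\<close> multiples of
  \<open>m\<close> and the whole of \<open>Z\<close>.\<close>

lemma ex_LC:
  fixes a b m :: nat
  assumes "0 < b" "0 < m" "b \<le> a" "a \<le> m * b"
  shows "\<exists>L. is_LC (a # replicate m b) L"
proof -
  define v :: int where "v = int (m * b)"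
  define Z where "Z = {0..<v}"
  define M1 where "M1 = (\<lambda>k. int (k * m)) ` {..<b}"
  have v: "v > 0" and fZ: "finite Z" and cZ: "card Z = m * b"
    using assms by (auto simp: v_def Z_def simp flip: of_nat_mult)
  have Zmod: "p mod v \<in> Z" for p
    using v by (simp add: Z_def)
  have cM1: "card M1 = b"
    using assms by (simp add: M1_def card_image inj_on_def)
  have M1: "d \<in> M1" if d: "d \<in> Z" "int m dvd d" for d
  proof -
    obtain k where k: "d = int m * k" using d(2) by (rule dvdE)
    then have "0 \<le> k" "k < int b"
      using d assms by (auto simp: Z_def v_def zero_le_mult_iff)
    then show ?thesis
      using k unfolding M1_def by (intro image_eqI[of _ _ "nat k"]) auto
  qed
  have "M1 \<subseteq> Z"
    using assms by (auto simp: M1_def Z_def v_def simp flip: of_nat_mult)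
  then obtain M0 where M0: "M1 \<subseteq> M0" "M0 \<subseteq> Z" "card M0 = a"
    using exists_subset_between[of M1 a Z] assms cM1 cZ fZ by auto
  have fM0: "finite M0" using M0 fZ finite_subset by auto
  define E where "E = Z - M0"
  have cE: "card E = m * b - a"
    using M0 fM0 cZ by (simp add: E_def card_Diff_subset)
  have "0 \<in> M0"
    using M1[of 0] M0 v by (auto simp: Z_def)
  then have "E \<subseteq> {0<..<v}"
    by (auto simp: E_def Z_def order_less_le)
  from ex_near_orthomorphism[OF this] obtain \<phi> where
    \<phi>: "\<phi> ` E \<subseteq> Z" "inj_on \<phi> E" "inj_on (\<lambda>d. (\<phi> d - d) mod v) E"
    unfolding Z_def by blast
  \<comment> \<open>With \<open>d = x - y\<close>, the new symbol \<open>y + \<phi> d\<close> equals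
    \<open>x + \<theta> d\<close>: \<open>\<phi>\<close> controls it within a column,
    \<open>\<theta>\<close> within a row.\<close>
  define \<theta> where "\<theta> d = (\<phi> d - d) mod v" for d
  have \<theta>: "\<theta> ` E \<subseteq> Z" "inj_on \<theta> E"
    using \<phi>(3) Zmod by (auto simp: \<theta>_def[abs_def])
  \<comment> \<open>Since \<open>E\<close> has \<open>m * b - a\<close> elements, an injective image
    of it misses exactly \<open>a\<close> residues. Those missed by \<open>\<phi>\<close> feed the
    border rows, those missed by \<open>\<theta>\<close> the border columns.\<close>
  have ex: "\<exists>f. bij_betw f {..<a} (Z - g ` E)" if "g ` E \<subseteq> Z" "inj_on g E" for g
  proof (rule finite_same_card_bij)
    show "card {..<a} = card (Z - g ` E)"
      using that fZ cE cZ assms by (simp add: card_Diff_subset finite_subset card_image)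
  qed (use fZ in auto)
  obtain \<psi> where \<psi>: "bij_betw \<psi> {..<a} (Z - \<phi> ` E)" using ex[OF \<phi>(1,2)] by auto
  obtain \<chi> where \<chi>: "bij_betw \<chi> {..<a} (Z - \<theta> ` E)" using ex[OF \<theta>] by auto
  obtain \<beta> where \<beta>: "bij_betw \<beta> {..<a} M0"
    using finite_same_card_bij[of "{..<a}" M0] fM0 M0 by auto
  have \<psi>D: "\<psi> r \<in> Z" "\<psi> r \<notin> \<phi> ` E" if "r < a" for r
    using bij_betwE[OF \<psi>] that by auto
  have \<chi>D: "\<chi> r \<in> Z" "\<chi> r \<notin> \<theta> ` E" if "r < a" for r
    using bij_betwE[OF \<chi>] that by auto

  define D where "D x y = (int x - int y) mod v" for x y
  \<comment> \<open>\<open>Inl\<close> marks kept symbols, \<open>Inr\<close> new ones. Indices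
    below \<open>a\<close> form the border, whose corner is a cyclic square on \<open>M0\<close>;
    the others form the core.\<close>
  define Q :: "nat \<Rightarrow> nat \<Rightarrow> int + int" where
    "Q x y =
      (if x < a \<and> y < a then Inl (\<beta> ((x + y) mod a))
       else if x < a then Inr ((int y + \<psi> x) mod v)
       else if y < a then Inr ((int x + \<chi> y) mod v)
       else if D x y \<in> M0 then Inl (D x y)
       else Inr ((int y + \<phi> (D x y)) mod v))" for x y
  define N where "N = sum_list (a # replicate m b)"
  have N: "N = a + m * b"
    by (simp add: N_def sum_list_replicate)
  have DE: "D x y \<in> E" if "D x y \<notin> M0" for x y
    using that Zmod by (simp add: D_def E_def)
  have T: "(int y + \<phi> (D x y)) mod v = (int x + \<theta> (D x y)) mod v" for x y
  proof -
    have "(int x + \<theta> (D x y)) mod v = (int x + (\<phi> (D x y) - (int x - int y))) mod v"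
      unfolding \<theta>_def D_def by (simp add: mod_simps)
    then show ?thesis by (simp add: algebra_simps)
  qed
  \<comment> \<open>The core indices are \<open>v\<close> consecutive integers, so they represent
    each residue once and \<open>D\<close> can use them without subtracting
    \<open>a\<close>.\<close>
  have eqmod: "x = x'" if "int x mod v = int x' mod v" "a \<le> x" "x < N" "a \<le> x'" "x' < N" for x x'
  proof -
    have "int a + int (x - a) = int x" "int a + int (x' - a) = int x'"
      using that by linarith+
    then have "(int a + int (x - a)) mod v = (int a + int (x' - a)) mod v"
      using that(1) by (simp only:)
    moreover have "int (x - a) \<in> {0..<v}" "int (x' - a) \<in> {0..<v}"
      unfolding v_def atLeastLessThan_iff of_nat_less_iff using that N by linarith+
    ultimately have "int (x - a) = int (x' - a)"
      by (rule mod_add_left_cancel)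
    then show ?thesis
      using that by simp
  qed
  have shift: "x = x'" if "(int x + p) mod v = (int x' + p) mod v"
    "a \<le> x" "x < N" "a \<le> x'" "x' < N" for x x' p
  proof -
    have "(int x + p - p) mod v = (int x' + p - p) mod v"
      using that(1) by (metis mod_diff_left_eq)
    then show ?thesis using eqmod that by simp
  qed
  have Dinj1: "x = x'" if "D x y = D x' y" "a \<le> x" "x < N" "a \<le> x'" "x' < N" for x x' y
    using shift[of x "- int y" x'] that by (simp add: D_def)
  have Dinj2: "y = y'" if "D x y = D x y'" "a \<le> y" "y < N" "a \<le> y'" "y' < N" for x y y'
  proof -
    have "(int x - (int x - int y)) mod v = (int x - (int x - int y')) mod v"
      using that(1) unfolding D_def by (metis mod_diff_right_eq)
    then show ?thesis using eqmod that by simp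
  qed
  have cyc: "y = y'" if "(x + y) mod a = (x + y') mod a" "y < a" "y' < a" for x y y'
    using that mod_add_left_cancel[of "int x" "int y" "int a" "int y'"]
    by (simp flip: of_nat_add of_nat_mod)

  have row: "y = y'" if eq: "Q x y = Q x y'" and lt: "x < N" "y < N" "y' < N" for x y y'
  proof -
    \<comment> \<open>For a core row, a border entry \<open>x + \<chi> y\<close> cannot equal a new
      core entry \<open>x + \<theta> d\<close>, as \<open>\<chi>\<close> avoids the image of
      \<open>E\<close> under \<open>\<theta>\<close>; this excludes the mixed cases.\<close>
    consider "x < a" | "a \<le> x" "y < a" "y' < a" | "a \<le> x" "y < a" "a \<le> y'"
      | "a \<le> x" "a \<le> y" "y' < a" | "a \<le> x" "a \<le> y" "a \<le> y'"
      by linarith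
    then show ?thesis
    proof cases
      case 1
      then show ?thesis
        using eq lt shift[of y "\<psi> x" y'] cyc[of x y y'] bij_betw_imp_inj_on[OF \<beta>]
        by (auto simp: Q_def inj_on_eq_iff split: if_splits)
    next
      case 2
      then have "\<chi> y = \<chi> y'"
        using eq mod_add_left_cancel[of "int x" "\<chi> y" v "\<chi> y'"] \<chi>D
        by (auto simp: Q_def Z_def)
      then show ?thesis
        using 2 bij_betw_imp_inj_on[OF \<chi>] by (auto simp: inj_on_eq_iff)
    next
      case 3
      then show ?thesis
        using eq mod_add_left_cancel[of "int x" "\<chi> y" v "\<theta> (D x y')"] \<chi>D[of y] DE[of x y'] \<theta>(1)
        by (force simp: Q_def T Z_def split: if_splits)
    next
      case 4
      then show ?thesis
        using eq mod_add_left_cancel[of "int x" "\<chi> y'" v "\<theta> (D x y)"] \<chi>D[of y'] DE[of x y] \<theta>(1)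
        by (force simp: Q_def T Z_def split: if_splits)
    next
      case 5
      have "D x y = D x y'"
      proof (cases "D x y \<in> M0")
        case True
        then show ?thesis using 5 eq by (auto simp: Q_def split: if_splits)
      next
        case False
        then have "D x y' \<notin> M0" "(int x + \<theta> (D x y)) mod v = (int x + \<theta> (D x y')) mod v"
          using 5 eq by (auto simp: Q_def T split: if_splits)
        with False show ?thesis
          using mod_add_left_cancel[of "int x" "\<theta> (D x y)" v "\<theta> (D x y')"] DE \<theta>
          by (auto simp: Z_def image_subset_iff inj_on_eq_iff)
      qed
      then show ?thesis using Dinj2 5 lt by blast
    qed
  qed
  have col: "x = x'" if eq: "Q x y = Q x' y" and lt: "x < N" "x' < N" "y < N" for x x' y
  proof -
    \<comment> \<open>The row argument again, with new symbols measured from the column: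
      \<open>\<psi>\<close> and \<open>\<phi>\<close> replace \<open>\<chi>\<close> and
      \<open>\<theta>\<close>.\<close>
    consider "y < a" | "a \<le> y" "x < a" "x' < a" | "a \<le> y" "x < a" "a \<le> x'"
      | "a \<le> y" "a \<le> x" "x' < a" | "a \<le> y" "a \<le> x" "a \<le> x'"
      by linarith
    then show ?thesis
    proof cases
      case 1
      then show ?thesis
        using eq lt shift[of x "\<chi> y" x'] cyc[of y x x'] bij_betw_imp_inj_on[OF \<beta>]
        by (auto simp: Q_def inj_on_eq_iff add.commute split: if_splits)
    next
      case 2
      then have "\<psi> x = \<psi> x'"
        using eq mod_add_left_cancel[of "int y" "\<psi> x" v "\<psi> x'"] \<psi>D
        by (auto simp: Q_def Z_def)
      then show ?thesis
        using 2 bij_betw_imp_inj_on[OF \<psi>] by (auto simp: inj_on_eq_iff)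
    next
      case 3
      then show ?thesis
        using eq mod_add_left_cancel[of "int y" "\<psi> x" v "\<phi> (D x' y)"] \<psi>D[of x] DE[of x' y] \<phi>(1)
        by (force simp: Q_def Z_def split: if_splits)
    next
      case 4
      then show ?thesis
        using eq mod_add_left_cancel[of "int y" "\<psi> x'" v "\<phi> (D x y)"] \<psi>D[of x'] DE[of x y] \<phi>(1)
        by (force simp: Q_def Z_def split: if_splits)
    next
      case 5
      have "D x y = D x' y"
      proof (cases "D x y \<in> M0")
        case True
        then show ?thesis using 5 eq by (auto simp: Q_def split: if_splits)
      next
        case False
        then have "D x' y \<notin> M0" "(int y + \<phi> (D x y)) mod v = (int y + \<phi> (D x' y)) mod v"
          using 5 eq by (auto simp: Q_def split: if_splits)
        with False show ?thesis
          using mod_add_left_cancel[of "int y" "\<phi> (D x y)" v "\<phi> (D x' y)"] DE \<phi>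
          by (auto simp: Z_def image_subset_iff inj_on_eq_iff)
      qed
      then show ?thesis using Dinj1 5 lt by blast
    qed
  qed

  \<comment> \<open>\<open>t = 0\<close> is the corner; each \<open>t > 0\<close> takes the core
    offsets congruent to \<open>t - 1\<close> modulo \<open>m\<close>. All the small subsquares
    share the symbols \<open>M1\<close>.\<close>
  define R where "R t = (if t = 0 then {..<a} else (\<lambda>k. a + (k * m + (t - 1))) ` {..<b})" for t
  define M where "M t = (Inl ` (if t = 0 then M0 else M1) :: (int + int) set)" for t :: nat
  have hs: "(a # replicate m b) ! t = (if t = 0 then a else b)" if "t < Suc m" for t
    using that by (cases t) auto
  have RD: "a \<le> x" "(x - a) mod m = t - 1" if "x \<in> R t" "0 < t" "t < Suc m" for x t
    using that by (auto simp: R_def gr0_conv_Suc)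
  have QM: "Q x y \<in> M t" if t: "t < Suc m" and xy: "x \<in> R t" "y \<in> R t" for t x y
  proof (cases "t = 0")
    case True
    then show ?thesis
      using xy bij_betwE[OF \<beta>] by (auto simp: R_def M_def Q_def)
  next
    case False
    have "a \<le> x" "a \<le> y" and "(x - a) mod m = (y - a) mod m"
      using RD[of _ t] t xy False by auto
    then have "int (x - a) mod int m = int (y - a) mod int m"
      by (simp only: zmod_int[symmetric])
    then have "int m dvd int x - int y"
      using \<open>a \<le> x\<close> \<open>a \<le> y\<close> by (simp add: mod_eq_dvd_iff of_nat_diff)
    \<comment> \<open>\<open>m\<close> divides \<open>v\<close>, so reduction modulo
      \<open>v\<close> preserves divisibility by \<open>m\<close>.\<close>
    then have "int m dvd D x y"
      unfolding D_def v_def by (simp add: dvd_mod)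
    then have "D x y \<in> M1"
      using M1 Zmod by (simp add: D_def)
    then show ?thesis
      using M0 False \<open>a \<le> x\<close> \<open>a \<le> y\<close> by (auto simp: Q_def M_def)
  qed
  show ?thesis
  proof (rule is_LC_from_square[where Q = Q and Y = "Inl ` M0 \<union> Inr ` Z" and R = R and M = M],
      unfold N_def[symmetric])
    show "finite (Inl ` M0 \<union> Inr ` Z)"
      using fM0 fZ by simp
    have "card (Inl ` M0 \<union> Inr ` Z) = card M0 + card Z"
      using fM0 fZ by (subst card_Un_disjoint) (auto simp: card_image)
    then show "card (Inl ` M0 \<union> Inr ` Z) = N"
      using M0 cZ N by simp
    show "Q x y \<in> Inl ` M0 \<union> Inr ` Z" for x y
      using bij_betwE[OF \<beta>] Zmod by (auto simp: Q_def)
    show "inj_on (Q x) {..<N}" if "x < N" for x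
      using row that by (auto intro!: inj_onI)
    show "inj_on (\<lambda>x. Q x y) {..<N}" if "y < N" for y
      using col that by (auto intro!: inj_onI)
    show "R t \<subseteq> {..<N} \<and> card (R t) = (a # replicate m b) ! t"
      if "t < length (a # replicate m b)" for t
    proof (cases "t = 0")
      case False
      have "a + (k * m + (t - 1)) < N" if "k < b" for k
      proof -
        have "k * m + (t - 1) < Suc k * m"
          using False \<open>t < length (a # replicate m b)\<close> by auto
        also have "\<dots> \<le> b * m"
          using that by (intro mult_right_mono) auto
        finally show ?thesis by (simp add: N mult.commute)
      qed
      moreover have "card (R t) = b"
        using False \<open>0 < m\<close> by (cases t) (simp_all add: R_def card_image inj_on_def)
      ultimately show ?thesis
        using False that hs by (auto simp: R_def)
    qed (auto simp: R_def N)
    show "disjoint_family_on R {..<length (a # replicate m b)}"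
    proof (unfold disjoint_family_on_def, intro ballI impI)
      fix s t assume st: "s \<in> {..<length (a # replicate m b)}"
        "t \<in> {..<length (a # replicate m b)}" "s \<noteq> t"
      show "R s \<inter> R t = {}"
      proof (cases "s = 0 \<or> t = 0")
        case True
        then show ?thesis using st by (auto simp: R_def)
      next
        case False
        then have "s - 1 \<noteq> t - 1" using st by auto
        then show ?thesis
          using RD(2)[of _ s] RD(2)[of _ t] st False by fastforce
      qed
    qed
    show "finite (M t) \<and> card (M t) = (a # replicate m b) ! t"
      if "t < length (a # replicate m b)" for t
      using that hs M0 fM0 cM1 finite_subset[OF M0(1)] by (auto simp: M_def card_image)
    show "Q x y \<in> M t" if "t < length (a # replicate m b)" "x \<in> R t" "y \<in> R t" for t x y
      using QM that by simp
  qed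
qed

theorem theorem15:
  fixes a b n :: nat
  assumes "a > b" and "b > 0" and "n \<ge> 3"
  shows "(\<exists>L. is_LC (a # replicate (n - 1) b) L) \<longleftrightarrow> a \<le> (n - 1) * b"
proof
  assume "\<exists>L. is_LC (a # replicate (n - 1) b) L"
  then obtain L I J K S where L: "latin_cube (a + (n - 1) * b) L"
    and "\<forall>t < Suc (n - 1). subcube (a + (n - 1) * b) L ((a # replicate (n - 1) b) ! t)
           (I t) (J t) (K t) (S t)"
    unfolding is_LC_def by (auto simp: sum_list_replicate)
  then have "subcube (a + (n - 1) * b) L a (I 0) (J 0) (K 0) (S 0)"
    by auto
  \<comment> \<open>The counting bound reads \<open>2 * a \<le> a + (n - 1) * b\<close>; the subcube
    is proper because \<open>(n - 1) * b\<close> is positive.\<close>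
  from subcube_order_le[OF L this] show "a \<le> (n - 1) * b"
    using assms by auto
next
  assume "a \<le> (n - 1) * b"
  then show "\<exists>L. is_LC (a # replicate (n - 1) b) L"
    using assms by (intro ex_LC) auto
qed

end
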